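(* Let $q=2^d$ with $d$ a positive integer, $V=\mathrm{GF}(q^2)^2$, $\langle w\rangle\cong C_{q^2}$, and $G=\langle w\rangle\times(V,+)$. Let $\phi$ be the order $2$ automorphism of $G$ given by $(w^i,(x,y))^\phi:=(w^{-i},(x^q,y^q))$. Then the subgroup $$\mathcal{G}:=\langle(\phi,w,0,0),\ (1,w^2,0,0),\ (1,1,s,t) : (s,t)\in V\rangle$$ of $\langle\phi\rangle\ltimes G$ is a nonabelian group containing a $(q^4,q^2,q^4,q^2)$-relative difference set.
   Context: A subset $R$ of a finite group $G$ is an $(m,u,k,\lambda)$-relative difference set, relative to a subgroup $U\le G$ of order $u$ (the forbidden subgroup), if $|R|=k$, $|G|=mu$, and the multiset $\{r_1r_2^{-1} : r_1\ne r_2\in R\}$ contains each element of $G\setminus U$ exactly $\lambda$ times and contains no element of $U$. A group contains an $(m,u,k,\lambda)$-relative difference set if it does so relative to some subgroup of order $u$. Elements of $\langle\phi\rangle\ltimes G$ are written as $(a,b,c,e)$ with $a\in\langle\phi\rangle$, $b\in\langle w\rangle$, $(c,e)\in V$, standing for the pair $(a,(b,(c,e)))$. Automorphisms act on the right and multiplication of pairs is $(\alpha,g)(\beta,h)=(\alpha\beta,\ g^\beta h)$ for $\alpha,\beta\in\langle\phi\rangle$ and $g,h\in G$, where $G$ is the direct product of the multiplicative group $\langle w\rangle$ and the additive group $V$. *)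

theory Defs
  imports "HOL-Library.Multiset" "HOL-Algebra.Bij" "HOL-Algebra.Multiplicative_Group"
begin

definition quotient_mset :: "('a, 'b) monoid_scheme \<Rightarrow> 'a set \<Rightarrow> 'a multiset" where
  "quotient_mset G R =
     image_mset (\<lambda>(r1, r2). r1 \<otimes>\<^bsub>G\<^esub> inv\<^bsub>G\<^esub> r2) (mset_set {(r1, r2) \<in> R \<times> R. r1 \<noteq> r2})"

definition relative_difference_set ::
    "('a, 'b) monoid_scheme \<Rightarrow> 'a set \<Rightarrow> nat \<Rightarrow> nat \<Rightarrow> nat \<Rightarrow> nat \<Rightarrow> 'a set \<Rightarrow> bool" where
  "relative_difference_set G U m u k l R \<longleftrightarrow>
     group G \<and> finite (carrier G) \<and> subgroup U G \<and> card U = u \<and>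
     R \<subseteq> carrier G \<and> card R = k \<and> order G = m * u \<and>
     (\<forall>g \<in> carrier G - U. count (quotient_mset G R) g = l) \<and>
     (\<forall>g \<in> U. g \<notin># quotient_mset G R)"

definition contains_RDS ::
    "('a, 'b) monoid_scheme \<Rightarrow> nat \<Rightarrow> nat \<Rightarrow> nat \<Rightarrow> nat \<Rightarrow> bool" where
  "contains_RDS G m u k l \<longleftrightarrow> (\<exists>U R. relative_difference_set G U m u k l R)"

text \<open>Automorphisms act on the right, so the product of \<open>\<alpha>\<close> and \<open>\<beta>\<close> applies \<open>\<alpha>\<close> first. The library's
  \<^const>\<open>AutoGroup\<close> composes in the opposite order.\<close>

definition RAutoGroup :: "('a, 'b) monoid_scheme \<Rightarrow> ('a \<Rightarrow> 'a) monoid" where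
  "RAutoGroup G =
     \<lparr>carrier = auto G, monoid.mult = (\<lambda>\<alpha> \<beta>. \<beta> \<otimes>\<^bsub>AutoGroup G\<^esub> \<alpha>), one = \<one>\<^bsub>AutoGroup G\<^esub>\<rparr>"

text \<open>In the following definition \<open>A\<close> is meant to be a subgroup of \<^term>\<open>RAutoGroup G\<close>;
  \<open>\<beta> g\<close> is \<open>g\<^sup>\<beta>\<close> in exponential notation.\<close>

definition semidirect ::
    "('a \<Rightarrow> 'a, 'c) monoid_scheme \<Rightarrow> ('a, 'b) monoid_scheme \<Rightarrow> (('a \<Rightarrow> 'a) \<times> 'a) monoid"
    (infixr \<open>\<ltimes>\<close> 80) where
  "A \<ltimes> G =
     \<lparr>carrier = carrier A \<times> carrier G,
      monoid.mult = (\<lambda>(\<alpha>, g) (\<beta>, h). (\<alpha> \<otimes>\<^bsub>A\<^esub> \<beta>, \<beta> g \<otimes>\<^bsub>G\<^esub> h)),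
      one = (\<one>\<^bsub>A\<^esub>, \<one>\<^bsub>G\<^esub>)\<rparr>"

text \<open>\<open>C\<close> is the cyclic group \<open>\<langle>w\<rangle>\<close> of order \<open>q\<^sup>2\<close> and \<open>F\<close> is \<open>GF(q\<^sup>2)\<close>.\<close>

definition base_group ::
    "('c, 'm) monoid_scheme \<Rightarrow> ('f, 'n) ring_scheme \<Rightarrow> ('c \<times> 'f \<times> 'f) monoid" where
  "base_group C F = C \<times>\<times> (add_monoid F \<times>\<times> add_monoid F)"

definition phi ::
    "('c, 'm) monoid_scheme \<Rightarrow> ('f, 'n) ring_scheme \<Rightarrow> nat \<Rightarrow> 'c \<times> 'f \<times> 'f \<Rightarrow> 'c \<times> 'f \<times> 'f" where
  "phi C F q =
     (\<lambda>(b, x, y) \<in> carrier (base_group C F). (inv\<^bsub>C\<^esub> b, x [^]\<^bsub>F\<^esub> q, y [^]\<^bsub>F\<^esub> q))"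

definition phi_group ::
    "('c, 'm) monoid_scheme \<Rightarrow> ('f, 'n) ring_scheme \<Rightarrow> nat
      \<Rightarrow> ('c \<times> 'f \<times> 'f \<Rightarrow> 'c \<times> 'f \<times> 'f) monoid" where
  "phi_group C F q = subgroup_generated (RAutoGroup (base_group C F)) {phi C F q}"

definition extended_group ::
    "('c, 'm) monoid_scheme \<Rightarrow> ('f, 'n) ring_scheme \<Rightarrow> nat
      \<Rightarrow> (('c \<times> 'f \<times> 'f \<Rightarrow> 'c \<times> 'f \<times> 'f) \<times> 'c \<times> 'f \<times> 'f) monoid" where
  "extended_group C F q = phi_group C F q \<ltimes> base_group C F"

definition calG_generators ::
    "('c, 'm) monoid_scheme \<Rightarrow> ('f, 'n) ring_scheme \<Rightarrow> 'c \<Rightarrow> nat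
      \<Rightarrow> (('c \<times> 'f \<times> 'f \<Rightarrow> 'c \<times> 'f \<times> 'f) \<times> 'c \<times> 'f \<times> 'f) set" where
  "calG_generators C F w q =
     {(phi C F q, w, \<zero>\<^bsub>F\<^esub>, \<zero>\<^bsub>F\<^esub>),
      (\<one>\<^bsub>phi_group C F q\<^esub>, w [^]\<^bsub>C\<^esub> (2::nat), \<zero>\<^bsub>F\<^esub>, \<zero>\<^bsub>F\<^esub>)} \<union>
     {(\<one>\<^bsub>phi_group C F q\<^esub>, \<one>\<^bsub>C\<^esub>, s, t) | s t. s \<in> carrier F \<and> t \<in> carrier F}"

definition calG ::
    "('c, 'm) monoid_scheme \<Rightarrow> ('f, 'n) ring_scheme \<Rightarrow> 'c \<Rightarrow> nat
      \<Rightarrow> (('c \<times> 'f \<times> 'f \<Rightarrow> 'c \<times> 'f \<times> 'f) \<times> 'c \<times> 'f \<times> 'f) monoid" where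
  "calG C F w q = subgroup_generated (extended_group C F q) (calG_generators C F w q)"

text \<open>The remaining lemmas justify the definitions: \<^const>\<open>phi\<close> is an automorphism of order 2 given
  by the intended formula, \<^const>\<open>semidirect\<close> yields a group, and the generators lie in that group
  (\<^const>\<open>subgroup_generated\<close> silently discards generators outside the carrier).\<close>

lemma group_RAutoGroup:
  assumes "group G"
  shows "group (RAutoGroup G)"
proof -
  interpret A: group "AutoGroup G" using assms by (rule group.AutoGroup)
  have c: "carrier (AutoGroup G) = auto G" by (simp add: AutoGroup_def)
  show ?thesis
  proof (rule groupI)
    fix x assume "x \<in> carrier (RAutoGroup G)"
    then have "x \<in> carrier (AutoGroup G)" by (simp add: RAutoGroup_def c)
    then show "\<exists>y\<in>carrier (RAutoGroup G). y \<otimes>\<^bsub>RAutoGroup G\<^esub> x = \<one>\<^bsub>RAutoGroup G\<^esub>"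
      using A.inv_closed[of x] A.r_inv[of x]
      by (intro bexI[of _ "inv\<^bsub>AutoGroup G\<^esub> x"]) (auto simp: RAutoGroup_def c)
  qed (auto simp: RAutoGroup_def c[symmetric] A.m_assoc)
qed

lemma RAutoGroup_apply:
  assumes "\<alpha> \<in> auto G" "\<beta> \<in> auto G" "g \<in> carrier G"
  shows "(\<alpha> \<otimes>\<^bsub>RAutoGroup G\<^esub> \<beta>) g = \<beta> (\<alpha> g)"
  using assms by (simp add: RAutoGroup_def AutoGroup_def BijGroup_def auto_def compose_def)

lemma RAutoGroup_one_apply:
  "g \<in> carrier G \<Longrightarrow> \<one>\<^bsub>RAutoGroup G\<^esub> g = g"
  by (simp add: RAutoGroup_def AutoGroup_def BijGroup_def)

lemma semidirect_simps [simp]: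
  "carrier (A \<ltimes> G) = carrier A \<times> carrier G"
  "\<one>\<^bsub>A \<ltimes> G\<^esub> = (\<one>\<^bsub>A\<^esub>, \<one>\<^bsub>G\<^esub>)"
  "(\<alpha>, g) \<otimes>\<^bsub>A \<ltimes> G\<^esub> (\<beta>, h) = (\<alpha> \<otimes>\<^bsub>A\<^esub> \<beta>, \<beta> g \<otimes>\<^bsub>G\<^esub> h)"
  by (simp_all add: semidirect_def)

lemma group_semidirect:
  assumes G: "group G" and A: "subgroup H (RAutoGroup G)"
  shows "group ((RAutoGroup G)\<lparr>carrier := H\<rparr> \<ltimes> G)"
proof -
  interpret G: group G by fact
  interpret R: group "RAutoGroup G" using G by (rule group_RAutoGroup)
  interpret H: subgroup H "RAutoGroup G" by fact
  have aut: "\<alpha> \<in> auto G" if "\<alpha> \<in> H" for \<alpha>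
    using H.subset that by (auto simp: RAutoGroup_def)
  have clo: "\<alpha> g \<in> carrier G" if "\<alpha> \<in> H" "g \<in> carrier G" for \<alpha> g
    using aut[OF that(1)] that(2) by (auto simp: auto_def hom_def)
  have hom: "\<alpha> (g \<otimes>\<^bsub>G\<^esub> h) = \<alpha> g \<otimes>\<^bsub>G\<^esub> \<alpha> h"
    if "\<alpha> \<in> H" "g \<in> carrier G" "h \<in> carrier G" for \<alpha> g h
    using aut[OF that(1)] that by (auto simp: auto_def hom_def)
  have one: "\<alpha> \<one>\<^bsub>G\<^esub> = \<one>\<^bsub>G\<^esub>" if "\<alpha> \<in> H" for \<alpha>
    using hom[OF that G.one_closed G.one_closed] clo[OF that G.one_closed]
    by (simp add: G.one_unique G.l_cancel_one)
  show ?thesis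
  proof (rule groupI)
    fix x assume "x \<in> carrier ((RAutoGroup G)\<lparr>carrier := H\<rparr> \<ltimes> G)"
    then obtain \<alpha> g where x: "x = (\<alpha>, g)" "\<alpha> \<in> H" "g \<in> carrier G" by auto
    define \<beta> where "\<beta> = inv\<^bsub>RAutoGroup G\<^esub> \<alpha>"
    have b: "\<beta> \<in> H" "\<beta> \<otimes>\<^bsub>RAutoGroup G\<^esub> \<alpha> = \<one>\<^bsub>RAutoGroup G\<^esub>"
      using x by (auto simp: \<beta>_def H.mem_carrier)
    have "\<alpha> (\<beta> (inv\<^bsub>G\<^esub> g)) = inv\<^bsub>G\<^esub> g"
      using RAutoGroup_apply[OF aut[OF b(1)] aut[OF x(2)], of "inv\<^bsub>G\<^esub> g"] x(3)
      by (simp add: b(2) RAutoGroup_one_apply)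
    then have "(\<beta>, \<beta> (inv\<^bsub>G\<^esub> g)) \<otimes>\<^bsub>(RAutoGroup G)\<lparr>carrier := H\<rparr> \<ltimes> G\<^esub> x
        = \<one>\<^bsub>(RAutoGroup G)\<lparr>carrier := H\<rparr> \<ltimes> G\<^esub>"
      using x b by simp
    moreover have "(\<beta>, \<beta> (inv\<^bsub>G\<^esub> g)) \<in> carrier ((RAutoGroup G)\<lparr>carrier := H\<rparr> \<ltimes> G)"
      using b x clo by auto
    ultimately show "\<exists>y\<in>carrier ((RAutoGroup G)\<lparr>carrier := H\<rparr> \<ltimes> G).
        y \<otimes>\<^bsub>(RAutoGroup G)\<lparr>carrier := H\<rparr> \<ltimes> G\<^esub> x = \<one>\<^bsub>(RAutoGroup G)\<lparr>carrier := H\<rparr> \<ltimes> G\<^esub>"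
      by blast
  qed (auto simp: clo hom one R.m_assoc G.m_assoc H.mem_carrier RAutoGroup_apply aut
        RAutoGroup_one_apply)
qed

lemma group_base_group:
  assumes "group C" "field F"
  shows "group (base_group C F)"
proof -
  interpret F: field F by fact
  show ?thesis
    unfolding base_group_def
    by (intro DirProd_group assms F.add.is_group)
qed

lemma base_group_simps [simp]:
  "carrier (base_group C F) = carrier C \<times> carrier F \<times> carrier F"
  "\<one>\<^bsub>base_group C F\<^esub> = (\<one>\<^bsub>C\<^esub>, \<zero>\<^bsub>F\<^esub>, \<zero>\<^bsub>F\<^esub>)"
  "(b, x, y) \<otimes>\<^bsub>base_group C F\<^esub> (b', x', y') = (b \<otimes>\<^bsub>C\<^esub> b', x \<oplus>\<^bsub>F\<^esub> x', y \<oplus>\<^bsub>F\<^esub> y')"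
  by (simp_all add: base_group_def)

lemma phi_apply:
  assumes "group C" "w \<in> carrier C" "x \<in> carrier F" "y \<in> carrier F"
  shows "phi C F q (w [^]\<^bsub>C\<^esub> (i::int), x, y) = (w [^]\<^bsub>C\<^esub> (- i), x [^]\<^bsub>F\<^esub> q, y [^]\<^bsub>F\<^esub> q)"
proof -
  interpret C: group C by fact
  show ?thesis using assms by (simp add: phi_def C.int_pow_neg)
qed

context
  fixes d q :: nat and F :: "('f, 'n) ring_scheme" and C :: "('c, 'm) monoid_scheme" and w :: 'c
  assumes d: "d \<ge> 1" and q: "q = 2 ^ d"
    and F: "field F" and oF: "order F = q\<^sup>2"
    and C: "group C" and w: "w \<in> carrier C" and gen: "carrier C = generate C {w}"
    and oC: "order C = q\<^sup>2"
begin

interpretation F: field F by (rule F)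
interpretation C: group C by (rule C)

lemma char2:
  assumes x: "x \<in> carrier F"
  shows "x \<oplus>\<^bsub>F\<^esub> x = \<zero>\<^bsub>F\<^esub>"
proof -
  let ?t = "\<one>\<^bsub>F\<^esub> \<oplus>\<^bsub>F\<^esub> \<one>\<^bsub>F\<^esub>"
  have *: "[(2 ^ n :: nat)] \<cdot>\<^bsub>F\<^esub> \<one>\<^bsub>F\<^esub> = ?t [^]\<^bsub>F\<^esub> n" for n
  proof (induction n)
    case (Suc n)
    have "[(2 ^ Suc n :: nat)] \<cdot>\<^bsub>F\<^esub> \<one>\<^bsub>F\<^esub> = ?t [^]\<^bsub>F\<^esub> n \<oplus>\<^bsub>F\<^esub> ?t [^]\<^bsub>F\<^esub> n"
      by (simp add: mult_2 F.add.nat_pow_mult[symmetric] Suc)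
    then show ?case by (simp add: F.r_distr)
  qed simp
  have nz: "a [^]\<^bsub>F\<^esub> n \<noteq> \<zero>\<^bsub>F\<^esub>" if "a \<in> carrier F" "a \<noteq> \<zero>\<^bsub>F\<^esub>" for a and n :: nat
    using that by (induction n) (auto simp: F.integral_iff)
  have "order (add_monoid F) = 2 ^ (d * 2)"
    using oF q by (simp add: order_def power_mult)
  then have "[(2 ^ (d * 2) :: nat)] \<cdot>\<^bsub>F\<^esub> \<one>\<^bsub>F\<^esub> = \<zero>\<^bsub>F\<^esub>"
    using F.add.pow_order_eq_1[of "\<one>\<^bsub>F\<^esub>"] by (simp add: add_pow_def)
  then have t: "?t = \<zero>\<^bsub>F\<^esub>"
    using * nz[of ?t "d * 2"] by auto
  have "x \<oplus>\<^bsub>F\<^esub> x = x \<otimes>\<^bsub>F\<^esub> ?t" using x by (simp add: F.r_distr)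
  then show ?thesis using t x by simp
qed

lemma frob_add:
  assumes "x \<in> carrier F" "y \<in> carrier F"
  shows "(x \<oplus>\<^bsub>F\<^esub> y) [^]\<^bsub>F\<^esub> q = x [^]\<^bsub>F\<^esub> q \<oplus>\<^bsub>F\<^esub> y [^]\<^bsub>F\<^esub> q"
proof -
  have sq: "(a \<oplus>\<^bsub>F\<^esub> b) [^]\<^bsub>F\<^esub> (2::nat) = a [^]\<^bsub>F\<^esub> (2::nat) \<oplus>\<^bsub>F\<^esub> b [^]\<^bsub>F\<^esub> (2::nat)"
    if a: "a \<in> carrier F" and b: "b \<in> carrier F" for a b
  proof -
    have "(a \<oplus>\<^bsub>F\<^esub> b) [^]\<^bsub>F\<^esub> (2::nat)
        = a \<otimes>\<^bsub>F\<^esub> a \<oplus>\<^bsub>F\<^esub> ((a \<otimes>\<^bsub>F\<^esub> b \<oplus>\<^bsub>F\<^esub> a \<otimes>\<^bsub>F\<^esub> b) \<oplus>\<^bsub>F\<^esub> b \<otimes>\<^bsub>F\<^esub> b)"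
      using a b
      by (simp add: numeral_2_eq_2 F.l_distr F.r_distr F.a_ac F.m_comm)
    then show ?thesis using a b by (simp add: char2 numeral_2_eq_2)
  qed
  have "(x \<oplus>\<^bsub>F\<^esub> y) [^]\<^bsub>F\<^esub> (2 ^ n :: nat) = x [^]\<^bsub>F\<^esub> (2 ^ n :: nat) \<oplus>\<^bsub>F\<^esub> y [^]\<^bsub>F\<^esub> (2 ^ n :: nat)" for n
  proof (induction n)
    case (Suc n)
    have "z [^]\<^bsub>F\<^esub> (2 ^ Suc n :: nat) = (z [^]\<^bsub>F\<^esub> (2 ^ n :: nat)) [^]\<^bsub>F\<^esub> (2 :: nat)" if "z \<in> carrier F" for z
      using that by (simp add: F.nat_pow_pow mult.commute)
    then show ?case using Suc assms by (simp add: sq del: power_Suc)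
  qed (use assms in simp)
  then show ?thesis by (simp add: q)
qed

lemma frob_frob:
  assumes "x \<in> carrier F"
  shows "(x [^]\<^bsub>F\<^esub> q) [^]\<^bsub>F\<^esub> q = x"
proof (cases "x = \<zero>\<^bsub>F\<^esub>")
  case True
  then show ?thesis by (simp add: q F.nat_pow_zero)
next
  case False
  have fin: "finite (carrier F)" using oF q by (intro card_ge_0_finite) (simp add: order_def)
  have "x \<in> carrier (mult_of F)" using False assms by simp
  then have "x [^]\<^bsub>mult_of F\<^esub> order (mult_of F) = \<one>\<^bsub>mult_of F\<^esub>"
    using group.pow_order_eq_1[OF F.field_mult_group] by blast
  then have "x [^]\<^bsub>F\<^esub> (q\<^sup>2 - 1) = \<one>\<^bsub>F\<^esub>"
    using F.order_mult_of[OF fin] oF by (simp add: nat_pow_mult_of)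
  then have "x [^]\<^bsub>F\<^esub> Suc (q\<^sup>2 - 1) = x" using assms by simp
  moreover have "Suc (q\<^sup>2 - 1) = q * q" using q by (simp add: power2_eq_square)
  ultimately have "x [^]\<^bsub>F\<^esub> (q * q) = x" by metis
  then show ?thesis using assms by (simp add: F.nat_pow_pow)
qed

lemma comm_C: "x \<in> carrier C \<Longrightarrow> y \<in> carrier C \<Longrightarrow> x \<otimes>\<^bsub>C\<^esub> y = y \<otimes>\<^bsub>C\<^esub> x"
  using C.generate_pow[OF w] gen
  by (auto simp: C.int_pow_mult[OF w, symmetric] add.commute)

lemma phi_phi:
  "g \<in> carrier (base_group C F) \<Longrightarrow> phi C F q (phi C F q g) = g"
  by (auto simp: phi_def frob_frob)

lemma phi_auto: "phi C F q \<in> auto (base_group C F)"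
proof -
  have clo: "phi C F q \<in> carrier (base_group C F) \<rightarrow> carrier (base_group C F)"
    by (auto simp: phi_def)
  then have "phi C F q \<in> hom (base_group C F) (base_group C F)"
    by (auto simp: hom_def phi_def frob_add C.inv_mult_group comm_C)
  moreover have "bij_betw (phi C F q) (carrier (base_group C F)) (carrier (base_group C F))"
    by (rule bij_betw_byWitness[where f' = "phi C F q"]) (use clo phi_phi in \<open>auto simp del: base_group_simps\<close>)
  ultimately show ?thesis by (simp add: auto_def Bij_def phi_def)
qed

lemma phi_ord_2: "group.ord (RAutoGroup (base_group C F)) (phi C F q) = 2"
proof -
  let ?R = "RAutoGroup (base_group C F)" and ?f = "phi C F q"
  interpret R: group ?R by (intro group_RAutoGroup group_base_group C F)
  have f: "?f \<in> carrier ?R" by (simp add: RAutoGroup_def phi_auto)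
  have "?f \<otimes>\<^bsub>?R\<^esub> ?f = \<one>\<^bsub>?R\<^esub>"
  proof (rule extensionalityI)
    show "?f \<otimes>\<^bsub>?R\<^esub> ?f \<in> extensional (carrier (base_group C F))"
      using R.m_closed[OF f f] by (simp add: RAutoGroup_def auto_def Bij_def)
    show "\<one>\<^bsub>?R\<^esub> \<in> extensional (carrier (base_group C F))"
      using R.one_closed by (simp add: RAutoGroup_def auto_def Bij_def)
    show "(?f \<otimes>\<^bsub>?R\<^esub> ?f) g = \<one>\<^bsub>?R\<^esub> g" if "g \<in> carrier (base_group C F)" for g
      using that by (simp only: RAutoGroup_apply phi_auto RAutoGroup_one_apply phi_phi)
  qed
  then have "?f [^]\<^bsub>?R\<^esub> (2::nat) = \<one>\<^bsub>?R\<^esub>" using f by (simp add: numeral_2_eq_2)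
  then have "R.ord ?f dvd 2" using f R.pow_eq_id by blast
  moreover have "R.ord ?f \<noteq> 1"
  proof
    assume "R.ord ?f = 1"
    then have "?f = \<one>\<^bsub>?R\<^esub>" using R.ord_eq_1[OF f] by simp
    then have "?f (w, \<zero>\<^bsub>F\<^esub>, \<zero>\<^bsub>F\<^esub>) = (w, \<zero>\<^bsub>F\<^esub>, \<zero>\<^bsub>F\<^esub>)"
      using w by (simp add: RAutoGroup_one_apply)
    then have "inv\<^bsub>C\<^esub> w = w" using w by (simp add: phi_def)
    then have "w [^]\<^bsub>C\<^esub> (2::nat) = \<one>\<^bsub>C\<^esub>" using w C.r_inv[OF w] by (simp add: numeral_2_eq_2)
    then have "C.ord w dvd 2" using w C.pow_eq_id by blast
    moreover have "C.ord w = q\<^sup>2"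
      using C.generate_pow_card[OF w] gen oC by (simp add: order_def)
    moreover have "q\<^sup>2 \<ge> 2\<^sup>2"
      using d q power_increasing[of 1 d "2::nat"] by (intro power_mono) auto
    ultimately show False using dvd_imp_le[of "C.ord w" 2] by simp
  qed
  moreover have "n = 2" if "n dvd 2" "n \<noteq> 1" for n :: nat
    using that dvd_imp_le[of n 2] by (cases "n = 0") auto
  ultimately show ?thesis by blast
qed

lemma group_extended_group: "group (extended_group C F q)"
proof -
  interpret R: group "RAutoGroup (base_group C F)" by (intro group_RAutoGroup group_base_group C F)
  have "phi_group C F q = (RAutoGroup (base_group C F))\<lparr>carrier := carrier (phi_group C F q)\<rparr>"
    by (simp add: phi_group_def subgroup_generated_def)
  moreover have "subgroup (carrier (phi_group C F q)) (RAutoGroup (base_group C F))"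
    unfolding phi_group_def by (rule R.subgroup_subgroup_generated)
  ultimately show ?thesis
    unfolding extended_group_def using group_semidirect[OF group_base_group[OF C F]] by metis
qed

lemma calG_generators_subset: "calG_generators C F w q \<subseteq> carrier (extended_group C F q)"
proof -
  interpret R: group "RAutoGroup (base_group C F)" by (intro group_RAutoGroup group_base_group C F)
  have "phi C F q \<in> carrier (RAutoGroup (base_group C F))"
    by (simp add: RAutoGroup_def phi_auto)
  then have "phi C F q \<in> carrier (phi_group C F q)"
    by (simp add: phi_group_def carrier_subgroup_generated generate.incl)
  moreover have "\<one>\<^bsub>phi_group C F q\<^esub> \<in> carrier (phi_group C F q)"
    unfolding phi_group_def by (intro monoid.one_closed group.is_monoid R.group_subgroup_generated)
  ultimately show ?thesis
    using w by (auto simp: calG_generators_def extended_group_def)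
qed

end

end

theory Submission
  imports Defs
begin

text \<open>
  The first two generators of \<open>\<G>\<close> are the involution \<open>(\<phi>, w)\<close> and the
  element \<open>(1, w\<^sup>2)\<close>, which the involution inverts. They generate a group \<open>D\<close> of order \<open>q\<^sup>2\<close>, dihedral
  (a four-group if \<open>q = 2\<close>), with exactly one element over each \<open>c \<in> \<langle>w\<rangle>\<close>: its \<open>\<langle>\<phi>\<rangle>\<close>-part is \<open>1\<close> for
  an even power of \<open>w\<close> and \<open>\<phi>\<close> for an odd one. So \<open>\<G>\<close> is an extension of the normal subgroup \<open>V\<close> by
  \<open>D\<close>, in which odd elements act on \<open>V\<close> by the Frobenius map \<open>x \<mapsto> x\<^sup>q\<close>. This map moves some element,
  as \<open>x\<^sup>q = x\<close> has at most \<open>q\<close> solutions, and so \<open>\<G>\<close> is not abelian.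

  The difference set uses the spread of \<open>V\<close>, the \<open>q\<^sup>2 + 1\<close> lines through \<open>0\<close> in the plane over
  \<open>GF(q\<^sup>2)\<close>. The vertical line is the forbidden subgroup, and the other \<open>q\<^sup>2\<close> lines are distributed
  over \<open>D\<close>: \<open>R\<close> is the union of the cosets \<open>t\<^sub>c L\<^sub>c\<close>, where \<open>t\<^sub>c\<close> is the element of \<open>D\<close> over \<open>c\<close> and
  \<open>L\<^sub>c\<close> is the line of slope \<open>h c\<close>. Quotients between different cosets fill \<open>\<G> - V\<close> evenly since two
  distinct lines span \<open>V\<close>. Quotients within one coset give the conjugate line
  \<open>t\<^sub>c L\<^sub>c t\<^sub>c\<^sup>-\<^sup>1\<close>, whose slope is \<open>h c\<close> or \<open>(h c)\<^sup>q\<close>. They fill \<open>V\<close> off the vertical line evenly exactly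
  if these conjugates are again all the non-vertical lines. This counting is
  \<open>relative_difference_set_transversal\<close>.

  So \<open>h\<close> has to be a bijection from \<open>\<langle>w\<rangle>\<close> to \<open>GF(q\<^sup>2)\<close> that remains one after the Frobenius map is
  applied to its values at odd powers of \<open>w\<close>. It suffices that these values form a set that the
  Frobenius map preserves. Such a set of size \<open>q\<^sup>2 / 2\<close> exists by \<open>involution_invariant_subset\<close>,
  since \<open>q\<^sup>2 / 2\<close> is even; \<open>slopes_exist\<close> carries this out.
\<close>

section \<open>Relative difference sets from a transversal\<close>

context group
begin

text \<open>A quotient \<open>r\<^sub>1 r\<^sub>2\<^sup>-\<^sup>1 = g\<close> is determined by \<open>r\<^sub>2\<close>, because \<open>r\<^sub>1 = g r\<^sub>2\<close>. So counting
  quotients becomes counting the elements of \<open>R\<close> that left multiplication by \<open>g\<close> keeps in \<open>R\<close>.\<close>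

lemma count_quotient_mset:
  assumes R: "R \<subseteq> carrier G" "finite R" and g: "g \<in> carrier G" "g \<noteq> \<one>"
  shows "count (quotient_mset G R) g = card {r \<in> R. g \<otimes> r \<in> R}"
proof -
  let ?A = "{(r1, r2) \<in> R \<times> R. r1 \<noteq> r2}"
  have "finite ?A" using R by (auto intro: finite_subset[of _ "R \<times> R"])
  then have "count (quotient_mset G R) g = card ((\<lambda>(r1, r2). r1 \<otimes> inv r2) -` {g} \<inter> ?A)"
    unfolding quotient_mset_def by (simp add: count_image_mset)
  also have "(\<lambda>(r1, r2). r1 \<otimes> inv r2) -` {g} \<inter> ?A = {p \<in> ?A. (\<lambda>(r1, r2). r1 \<otimes> inv r2) p = g}"
    by auto
  also have "{p \<in> ?A. (\<lambda>(r1, r2). r1 \<otimes> inv r2) p = g} = (\<lambda>r. (g \<otimes> r, r)) ` {r \<in> R. g \<otimes> r \<in> R}"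
  proof (intro equalityI subsetI)
    fix p assume "p \<in> {p \<in> ?A. (\<lambda>(r1, r2). r1 \<otimes> inv r2) p = g}"
    then obtain r1 r2 where p: "p = (r1, r2)" "r1 \<in> R" "r2 \<in> R" "r1 \<otimes> inv r2 = g" by auto
    moreover have "r1 \<in> carrier G" "r2 \<in> carrier G" using p R by auto
    ultimately have "r1 = g \<otimes> r2" using g inv_solve_right[of g r1 r2] by simp
    with p show "p \<in> (\<lambda>r. (g \<otimes> r, r)) ` {r \<in> R. g \<otimes> r \<in> R}" by auto
  next
    fix p assume "p \<in> (\<lambda>r. (g \<otimes> r, r)) ` {r \<in> R. g \<otimes> r \<in> R}"
    then obtain r where r: "p = (g \<otimes> r, r)" "r \<in> R" "g \<otimes> r \<in> R" by auto
    moreover have "r \<in> carrier G" using r R by auto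
    ultimately show "p \<in> {p \<in> ?A. (\<lambda>(r1, r2). r1 \<otimes> inv r2) p = g}"
      using g by (auto simp: m_assoc)
  qed
  also have "card \<dots> = card {r \<in> R. g \<otimes> r \<in> R}"
    by (rule card_image) (auto simp: inj_on_def)
  finally show ?thesis .
qed

lemma one_notin_quotient_mset:
  assumes R: "R \<subseteq> carrier G" "finite R"
  shows "\<one> \<notin># quotient_mset G R"
proof -
  have "finite {(r1, r2) \<in> R \<times> R. r1 \<noteq> r2}"
    using R by (auto intro: finite_subset[of _ "R \<times> R"])
  moreover have "\<one> \<noteq> r1 \<otimes> inv r2" if "r1 \<in> R" "r2 \<in> R" "r1 \<noteq> r2" for r1 r2
  proof
    assume "\<one> = r1 \<otimes> inv r2"
    moreover have "r1 \<in> carrier G" "r2 \<in> carrier G" using that R by auto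
    ultimately show False using that inv_solve_right[of \<one> r1 r2] by auto
  qed
  ultimately show ?thesis unfolding quotient_mset_def by auto
qed

text \<open>If \<open>|A| |B| = |N|\<close> and \<open>A \<inter> B = 1\<close>, then \<open>N = A B\<close>, so every left translate of \<open>B\<close>
  within \<open>N\<close> meets \<open>A\<close> exactly once.\<close>

lemma ex1_translate_in_complement:
  assumes N: "subgroup N G" "finite N"
    and A: "subgroup A G" "A \<subseteq> N" and B: "subgroup B G" "B \<subseteq> N"
    and AB: "A \<inter> B = {\<one>}" and card: "card A * card B = card N" and n: "n \<in> N"
  shows "\<exists>!b. b \<in> B \<and> n \<otimes> b \<in> A"
proof -
  interpret N: subgroup N G by fact
  interpret A: subgroup A G by fact
  interpret B: subgroup B G by fact
  let ?f = "\<lambda>(a, b). a \<otimes> inv b"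
  have eq: "b = b'" if "b \<in> B" "b' \<in> B" "m \<in> carrier G" "m \<otimes> b \<in> A" "m \<otimes> b' \<in> A" for m b b'
  proof -
    have "inv (m \<otimes> b) \<otimes> (m \<otimes> b') \<in> A" using that by auto
    moreover have "inv (m \<otimes> b) \<otimes> (m \<otimes> b') = inv b \<otimes> b'"
      using that by (simp add: inv_mult_group m_assoc) (simp add: m_assoc[symmetric])
    ultimately have "inv b \<otimes> b' \<in> A \<inter> B" using that by auto
    then have "inv b \<otimes> b' = \<one>" using AB by simp
    then show ?thesis using that inv_solve_left[of \<one> b b'] by simp
  qed
  have "inj_on ?f (A \<times> B)"
  proof (rule inj_onI, clarify)
    fix a b a' b' assume *: "a \<in> A" "b \<in> B" "a' \<in> A" "b' \<in> B" "a \<otimes> inv b = a' \<otimes> inv b'"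
    have "(a \<otimes> inv b) \<otimes> b = a" "(a' \<otimes> inv b') \<otimes> b' = a'"
      using *(1-4) by (simp_all add: m_assoc)
    then have "b = b'" using eq[of b b' "a \<otimes> inv b"] * by auto
    then have "a = a'" using * by (simp add: right_cancel)
    with \<open>b = b'\<close> show "a = a' \<and> b = b'" by simp
  qed
  then have "card (?f ` (A \<times> B)) = card N" by (simp add: card_image card_cartesian_product card)
  moreover have "?f ` (A \<times> B) \<subseteq> N" using A(2) B(2) by auto
  ultimately have "?f ` (A \<times> B) = N" using N(2) by (simp add: card_subset_eq)
  then obtain a b where "a \<in> A" "b \<in> B" "n = a \<otimes> inv b" using n by auto
  then have "b \<in> B" "n \<otimes> b \<in> A" by (simp_all add: m_assoc)
  then show ?thesis using eq[of _ _ n] n by (intro ex1I[of _ b]) auto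
qed

text \<open>Write \<open>R = \<Sum>\<^sub>i t\<^sub>i H\<^sub>i\<close> in the group ring and expand \<open>R R\<^sup>-\<^sup>1\<close>. For \<open>i \<noteq> j\<close> the
  product of \<open>H\<^sub>i\<close> and \<open>H\<^sub>j\<close> is \<open>N\<close>, so the mixed terms \<open>t\<^sub>i H\<^sub>i H\<^sub>j t\<^sub>j\<^sup>-\<^sup>1 = t\<^sub>i t\<^sub>j\<^sup>-\<^sup>1 N\<close> cover every
  coset of \<open>N\<close> but \<open>N\<close> itself, \<open>n\<close> times each. The diagonal terms are \<open>n\<close> times the conjugates
  \<open>t\<^sub>i H\<^sub>i t\<^sub>i\<^sup>-\<^sup>1\<close>. Each element of \<open>N\<close> outside \<open>U\<close> lies in exactly one of these conjugates, and
  the only element of \<open>U\<close> that any of them contains is the identity. The assumptions \<open>cover\<close> and \<open>avoid\<close>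
  express this, with \<open>g t \<in> t H\<close> in place of \<open>g \<in> t H t\<^sup>-\<^sup>1\<close>.\<close>

theorem relative_difference_set_transversal:
  fixes I :: "'i set" and t :: "'i \<Rightarrow> 'a" and H :: "'i \<Rightarrow> 'a set"
  assumes fin: "finite (carrier G)"
    and N: "N \<lhd> G" and cN: "card N = n\<^sup>2" and cI: "card I = n" and n: "n > 0"
    and t: "\<And>i. i \<in> I \<Longrightarrow> t i \<in> carrier G"
    and transversal: "\<And>g. g \<in> carrier G \<Longrightarrow> \<exists>!i. i \<in> I \<and> g \<in> t i <# N"
    and H: "\<And>i. i \<in> I \<Longrightarrow> subgroup (H i) G" "\<And>i. i \<in> I \<Longrightarrow> H i \<subseteq> N"
      "\<And>i. i \<in> I \<Longrightarrow> card (H i) = n"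
    and disj: "\<And>i j. i \<in> I \<Longrightarrow> j \<in> I \<Longrightarrow> i \<noteq> j \<Longrightarrow> H i \<inter> H j = {\<one>}"
    and U: "subgroup U G" "U \<subseteq> N" "card U = n"
    and cover: "\<And>g. g \<in> N - U \<Longrightarrow> \<exists>!i. i \<in> I \<and> g \<otimes> t i \<in> t i <# H i"
    and avoid: "\<And>g i. g \<in> U \<Longrightarrow> g \<noteq> \<one> \<Longrightarrow> i \<in> I \<Longrightarrow> g \<otimes> t i \<notin> t i <# H i"
  shows "relative_difference_set G U (n\<^sup>2) n (n\<^sup>2) n (\<Union>i\<in>I. t i <# H i)"
proof -
  interpret N: normal N G by fact
  define R where "R = (\<Union>i\<in>I. t i <# H i)"
  have Nc: "N \<subseteq> carrier G" by (rule N.subset)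
  have Hc: "x \<in> carrier G" if "i \<in> I" "x \<in> H i" for i x using H(2) Nc that by blast
  have finI: "finite I" using cI n by (intro card_ge_0_finite) simp
  have finN: "finite N" using fin Nc finite_subset by blast
  have finH: "finite (H i)" if "i \<in> I" for i using H(2) finN finite_subset that by blast
  have R: "R \<subseteq> carrier G" using t Hc by (auto simp: R_def l_coset_def)
  then have finR: "finite R" using fin finite_subset by blast
  have uniq: "i = j" if "i \<in> I" "j \<in> I" "x \<in> N" "y \<in> N" "t i \<otimes> x = t j \<otimes> y" for i j x y
  proof -
    have "t i \<otimes> x \<in> carrier G" using that t Nc by auto
    moreover have "t i \<otimes> x \<in> t i <# N"
      using that(3) by (auto simp: l_coset_def)
    moreover have "t i \<otimes> x \<in> t j <# N"
      unfolding that(5) using that(4) by (auto simp: l_coset_def)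
    ultimately show ?thesis using transversal that by blast
  qed
  have in_R: "t j \<otimes> x \<in> R \<longleftrightarrow> x \<in> H j" if "j \<in> I" "x \<in> N" for j x
  proof
    assume "t j \<otimes> x \<in> R"
    then obtain i y where iy: "i \<in> I" "y \<in> H i" "t j \<otimes> x = t i \<otimes> y"
      by (auto simp: R_def l_coset_def)
    with that have "j = i" using uniq H(2) by blast
    then show "x \<in> H j" using iy that t Nc Hc by auto
  qed (use that in \<open>auto simp: R_def l_coset_def\<close>)
  have img: "inj_on (\<lambda>(i, x). t i \<otimes> x) (Sigma I K)" if "\<And>i. i \<in> I \<Longrightarrow> K i \<subseteq> N" for K
  proof (rule inj_onI, clarify)
    fix i x j y assume *: "i \<in> I" "x \<in> K i" "j \<in> I" "y \<in> K j" "t i \<otimes> x = t j \<otimes> y"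
    then have "x \<in> N" "y \<in> N" using that by auto
    then show "i = j \<and> x = y" using uniq[of i j x y] * t Nc by auto
  qed
  have "carrier G = (\<lambda>(i, x). t i \<otimes> x) ` (I \<times> N)"
    using transversal t Nc by (fastforce simp: l_coset_def)
  then have "order G = card (I \<times> N)"
    using card_image[OF img[of "\<lambda>_. N"]] by (simp add: order_def)
  then have order: "order G = n\<^sup>2 * n" by (simp add: card_cartesian_product cI cN)
  have R_img: "R = (\<lambda>(i, x). t i \<otimes> x) ` (Sigma I H)"
    by (auto simp: R_def l_coset_def)
  then have "card R = card (Sigma I H)" using card_image[OF img[of H]] H(2) by simp
  then have cR: "card R = n\<^sup>2" using finI finH H(3) cI by (simp add: power2_eq_square)

  define K where "K g i = {x \<in> H i. g \<otimes> (t i \<otimes> x) \<in> R}" for g i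
  have count: "count (quotient_mset G R) g = (\<Sum>i\<in>I. card (K g i))"
    if g: "g \<in> carrier G" "g \<noteq> \<one>" for g
  proof -
    have "{r \<in> R. g \<otimes> r \<in> R} = (\<lambda>(i, x). t i \<otimes> x) ` (Sigma I (K g))"
    proof (intro equalityI subsetI)
      fix r assume r: "r \<in> {r \<in> R. g \<otimes> r \<in> R}"
      then obtain i x where "i \<in> I" "x \<in> H i" "r = t i \<otimes> x" using R_img by auto
      then show "r \<in> (\<lambda>(i, x). t i \<otimes> x) ` (Sigma I (K g))" using r by (force simp: K_def)
    qed (use R_img in \<open>auto simp: K_def\<close>)
    then have "card {r \<in> R. g \<otimes> r \<in> R} = card (Sigma I (K g))"
      using card_image[OF img[of "K g"]] H(2) by (auto simp: K_def)
    also have "\<dots> = (\<Sum>i\<in>I. card (K g i))"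
      using finI finH by (intro card_SigmaI) (auto simp: K_def)
    finally show ?thesis using count_quotient_mset[OF R finR g] by simp
  qed
  have outside: "card (K g i) = 1" if g: "g \<in> carrier G" "g \<notin> N" and i: "i \<in> I" for g i
  proof -
    obtain j m where j: "j \<in> I" "m \<in> N" "g \<otimes> t i = t j \<otimes> m"
      using transversal[of "g \<otimes> t i"] g t[OF i] by (auto simp: l_coset_def)
    have "j \<noteq> i"
    proof
      assume "j = i"
      then have "g = t i \<otimes> m \<otimes> inv (t i)"
        using j g t[OF i] Nc inv_solve_right[of g "t i \<otimes> m" "t i"] by auto
      then show False using N.inv_op_closed2[OF t[OF i] j(2)] g by simp
    qed
    have "g \<otimes> (t i \<otimes> x) \<in> R \<longleftrightarrow> m \<otimes> x \<in> H j" if "x \<in> H i" for x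
    proof -
      have xN: "x \<in> N" using that H(2) i by auto
      then have "g \<otimes> (t i \<otimes> x) = t j \<otimes> (m \<otimes> x)"
        using g t i j Nc by (simp add: m_assoc[symmetric] subset_eq)
      then show ?thesis using in_R[of j "m \<otimes> x"] j xN by simp
    qed
    then have K: "K g i = {x. x \<in> H i \<and> m \<otimes> x \<in> H j}" by (auto simp: K_def)
    have "\<exists>!x. x \<in> H i \<and> m \<otimes> x \<in> H j"
      using disj[OF j(1) i \<open>j \<noteq> i\<close>] H i j finN cN N.subgroup_axioms
      by (intro ex1_translate_in_complement[of N]) (auto simp: power2_eq_square)
    then obtain x where "K g i = {x}" unfolding K by blast
    then show ?thesis by simp
  qed
  have inside: "card (K g i) = (if g \<otimes> t i \<in> t i <# H i then n else 0)"
    if g: "g \<in> N" and i: "i \<in> I" for g i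
  proof -
    interpret Hi: subgroup "H i" G using H(1) i by blast
    define m where "m = inv (t i) \<otimes> g \<otimes> t i"
    have m: "m \<in> N" unfolding m_def using N.inv_op_closed1 t i g by simp
    have mc: "m \<in> carrier G" "g \<in> carrier G" using m g Nc by auto
    have gt: "g \<otimes> t i = t i \<otimes> m" using t[OF i] mc unfolding m_def
      by (simp add: m_assoc[symmetric])
    have "g \<otimes> (t i \<otimes> x) \<in> R \<longleftrightarrow> m \<in> H i" if x: "x \<in> H i" for x
    proof -
      have xN: "x \<in> N" using x H(2) i by auto
      have "g \<otimes> (t i \<otimes> x) = t i \<otimes> (m \<otimes> x)"
        using gt mc t[OF i] x Hc[OF i x] by (simp add: m_assoc[symmetric])
      then have "g \<otimes> (t i \<otimes> x) \<in> R \<longleftrightarrow> m \<otimes> x \<in> H i" using in_R[of i "m \<otimes> x"] i xN m by simp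
      also have "\<dots> \<longleftrightarrow> m \<in> H i"
      proof
        assume "m \<otimes> x \<in> H i"
        then have "(m \<otimes> x) \<otimes> inv x \<in> H i" using x by blast
        then show "m \<in> H i" using mc Hc[OF i x] by (simp add: m_assoc)
      qed (use x in blast)
      finally show ?thesis .
    qed
    moreover have "g \<otimes> t i \<in> t i <# H i \<longleftrightarrow> m \<in> H i"
      using t[OF i] mc Hc[OF i] unfolding gt by (auto simp: l_coset_def)
    ultimately have "K g i = (if g \<otimes> t i \<in> t i <# H i then H i else {})"
      by (auto simp: K_def)
    then show ?thesis using H(3) i by simp
  qed
  have "count (quotient_mset G R) g = n" if g: "g \<in> carrier G - U" for g
  proof -
    have g1: "g \<in> carrier G" "g \<noteq> \<one>" using g subgroup.one_closed[OF U(1)] by auto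
    show ?thesis
    proof (cases "g \<in> N")
      case True
      then obtain i0 where i0: "i0 \<in> I" "g \<otimes> t i0 \<in> t i0 <# H i0"
        "\<And>i. i \<in> I \<Longrightarrow> g \<otimes> t i \<in> t i <# H i \<Longrightarrow> i = i0"
        using cover[of g] g by blast
      have "g \<otimes> t i \<in> t i <# H i \<longleftrightarrow> i = i0" if "i \<in> I" for i
        using i0 that by blast
      then have "(\<Sum>i\<in>I. card (K g i)) = (\<Sum>i\<in>I. if i = i0 then n else 0)"
        using inside[OF True] by (intro sum.cong) simp_all
      then show ?thesis using count[OF g1] i0(1) finI by simp
    next
      case False
      then show ?thesis using count[OF g1] outside[of g] g1 cI by simp
    qed
  qed
  moreover have "g \<notin># quotient_mset G R" if g: "g \<in> U" for g
  proof (cases "g = \<one>")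
    case True
    then show ?thesis using one_notin_quotient_mset[OF R finR] by simp
  next
    case False
    have "g \<in> N" using g U by auto
    then have "count (quotient_mset G R) g = 0"
      using count[of g] inside[of g] avoid[OF g False] False Nc by (simp add: subset_eq)
    then show ?thesis by (simp add: count_eq_zero_iff)
  qed
  ultimately have "relative_difference_set G U (n\<^sup>2) n (n\<^sup>2) n R"
    using fin U R cR order is_group by (simp add: relative_difference_set_def)
  then show ?thesis by (simp add: R_def)
qed

end

section \<open>Invariant sets of an involution\<close>

text \<open>Orbits of an involution have size one or two, and two points that are not in orbits of size
  two are fixed. So an invariant set with two points outside it can grow by exactly two points.\<close>

lemma involution_invariant_subset:
  assumes A: "finite A" and f: "\<And>x. x \<in> A \<Longrightarrow> f x \<in> A" "\<And>x. x \<in> A \<Longrightarrow> f (f x) = x"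
    and k: "2 * k \<le> card A"
  shows "\<exists>M \<subseteq> A. card M = 2 * k \<and> f ` M = M"
  using k
proof (induction k)
  case (Suc k)
  then obtain M where M: "M \<subseteq> A" "card M = 2 * k" "f ` M = M" by auto
  then have finM: "finite M" using A finite_subset by blast
  have out: "f x \<notin> M" if "x \<in> A - M" for x
    using that f M by (metis DiffD1 DiffD2 imageI)
  have "card (A - M) \<ge> 2" using Suc.prems M finM by (simp add: card_Diff_subset)
  then obtain x y where xy: "x \<in> A - M" "y \<in> A - M" "x \<noteq> y"
    by (metis card_le_Suc0_iff_eq A finite_Diff not_less_eq_eq numeral_2_eq_2)
  have "\<exists>u v. u \<in> A - M \<and> v \<in> A - M \<and> u \<noteq> v \<and> f ` {u, v} = {u, v}"
  proof (cases "f x = x \<and> f y = y")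
    case True
    then show ?thesis using xy by (intro exI[of _ x] exI[of _ y]) auto
  next
    case False
    then obtain z where "z \<in> A - M" "f z \<noteq> z" using xy by blast
    then show ?thesis using f out by (intro exI[of _ z] exI[of _ "f z"]) auto
  qed
  then obtain u v where uv: "u \<in> A - M" "v \<in> A - M" "u \<noteq> v" "f ` {u, v} = {u, v}" by blast
  then have "card (M \<union> {u, v}) = 2 * Suc k" using M finM by simp
  moreover have "f ` (M \<union> {u, v}) = M \<union> {u, v}" using M(3) uv(4) by (metis image_Un)
  ultimately show ?case using M(1) uv by (intro exI[of _ "M \<union> {u, v}"]) auto
qed auto

section \<open>The extension of the plane by the dihedral group\<close>

locale frobenius_extension =
  fixes d q :: nat
    and F :: "('f, 'n) ring_scheme" (structure)
    and C :: "('c, 'm) monoid_scheme"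
    and w :: 'c
  assumes d: "d \<ge> 1" and q: "q = 2 ^ d"
    and F: "field F" and oF: "order F = q\<^sup>2"
    and C: "group C" and w: "w \<in> carrier C" and gen: "carrier C = generate C {w}"
    and oC: "order C = q\<^sup>2"
begin

sublocale F: field F by (rule F)
sublocale C: group C by (rule C)

lemmas setting = d q F oF C w gen oC

definition evens :: "'c set" where
  "evens = generate C {w [^]\<^bsub>C\<^esub> (2::nat)}"

text \<open>The actions on \<open>GF(q\<^sup>2)\<close> and on \<open>\<langle>w\<rangle>\<close> of the \<open>\<langle>\<phi>\<rangle>\<close>-part attached to \<open>c\<close>. Both have order at
  most two, which is why no inverse of them ever appears.\<close>

definition twist :: "'c \<Rightarrow> 'f \<Rightarrow> 'f" where
  "twist c x = (if c \<in> evens then x else x [^] q)"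

definition ctwist :: "'c \<Rightarrow> 'c \<Rightarrow> 'c" where
  "ctwist c b = (if c \<in> evens then b else inv\<^bsub>C\<^esub> b)"

text \<open>The coordinates of \<open>\<G>\<close>: in every element of \<open>\<G>\<close> the \<open>\<langle>\<phi>\<rangle>\<close>-part is determined by the parity of
  the \<open>\<langle>w\<rangle>\<close>-part, so the latter alone can serve as index.\<close>

definition elem :: "'c \<Rightarrow> 'f \<Rightarrow> 'f \<Rightarrow> ('c \<times> 'f \<times> 'f \<Rightarrow> 'c \<times> 'f \<times> 'f) \<times> 'c \<times> 'f \<times> 'f" where
  "elem c x y = (if c \<in> evens then \<one>\<^bsub>phi_group C F q\<^esub> else phi C F q, c, x, y)"

abbreviation "X \<equiv> extended_group C F q"
abbreviation "\<G> \<equiv> calG C F w q"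

lemma q_gt_1: "q > 1"
  using d q one_less_power[of "2::nat" d] by simp

lemma card_F: "card (carrier F) = q\<^sup>2" and fin_F: "finite (carrier F)"
  and card_C: "card (carrier C) = q\<^sup>2" and fin_C: "finite (carrier C)"
proof -
  show "card (carrier F) = q\<^sup>2" "card (carrier C) = q\<^sup>2" using oF oC by (simp_all add: order_def)
  then show "finite (carrier F)" "finite (carrier C)"
    using q_gt_1 by (auto intro!: card_ge_0_finite)
qed

lemma C_comm: "a \<in> carrier C \<Longrightarrow> b \<in> carrier C \<Longrightarrow> a \<otimes>\<^bsub>C\<^esub> b = b \<otimes>\<^bsub>C\<^esub> a"
  by (rule comm_C[OF setting])

lemma even_q2: "even (q\<^sup>2)"
  using d q by simp

lemma w_pow: "carrier C = {w [^]\<^bsub>C\<^esub> k | k :: nat. True}"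
  using C.generate_pow_on_finite_carrier[OF fin_C w] gen by auto

lemma evens_pow: "evens = {w [^]\<^bsub>C\<^esub> (2 * k) | k :: nat. True}"
  unfolding evens_def using C.generate_pow_on_finite_carrier[OF fin_C, of "w [^]\<^bsub>C\<^esub> (2::nat)"] w
  by (auto simp: C.nat_pow_pow)

text \<open>Parity of the exponent is well defined on \<open>\<langle>w\<rangle>\<close> because the order of \<open>w\<close> is even.\<close>

lemma w_pow_evens: "w [^]\<^bsub>C\<^esub> k \<in> evens \<longleftrightarrow> even k" for k :: nat
proof
  assume "w [^]\<^bsub>C\<^esub> k \<in> evens"
  then obtain j :: nat where "w [^]\<^bsub>C\<^esub> k = w [^]\<^bsub>C\<^esub> (2 * j)" by (auto simp: evens_pow)
  then have "w [^]\<^bsub>C\<^esub> int k = w [^]\<^bsub>C\<^esub> int (2 * j)" by (simp only: int_pow_int)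
  then have "int (C.ord w) dvd int (2 * j) - int k" using C.int_pow_eq[OF w] by blast
  moreover have "C.ord w = q\<^sup>2" using C.generate_pow_card[OF w] gen card_C by simp
  ultimately have "2 dvd int (2 * j) - int k"
    using even_q2 by (metis dvd_trans int_dvd_int_iff of_nat_numeral)
  then show "even k" by presburger
qed (auto simp: evens_pow elim: evenE)

lemma evens_subgroup: "subgroup evens C"
  unfolding evens_def using w by (intro C.generate_is_subgroup) auto

lemma evens_carrier: "c \<in> evens \<Longrightarrow> c \<in> carrier C"
  using subgroup.subset[OF evens_subgroup] by auto

lemma one_evens [simp]: "\<one>\<^bsub>C\<^esub> \<in> evens"
  by (rule subgroup.one_closed[OF evens_subgroup])

lemma w_not_evens: "w \<notin> evens"
  using w_pow_evens[of "1::nat"] w by (simp add: C.nat_pow_eone)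

lemma mult_evens:
  assumes "a \<in> carrier C" "b \<in> carrier C"
  shows "a \<otimes>\<^bsub>C\<^esub> b \<in> evens \<longleftrightarrow> (a \<in> evens \<longleftrightarrow> b \<in> evens)"
proof -
  from assms obtain i j :: nat where "a = w [^]\<^bsub>C\<^esub> i" "b = w [^]\<^bsub>C\<^esub> j" using w_pow by auto
  then show ?thesis by (simp add: C.nat_pow_mult[OF w] w_pow_evens)
qed

lemma inv_evens: "a \<in> carrier C \<Longrightarrow> inv\<^bsub>C\<^esub> a \<in> evens \<longleftrightarrow> a \<in> evens"
  using mult_evens[of a "inv\<^bsub>C\<^esub> a"] by simp

lemma ctwist_closed [simp]: "b \<in> carrier C \<Longrightarrow> ctwist c b \<in> carrier C"
  by (simp add: ctwist_def)

lemma ctwist_one [simp]: "ctwist c \<one>\<^bsub>C\<^esub> = \<one>\<^bsub>C\<^esub>"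
  by (simp add: ctwist_def)

lemma twist_closed [simp]: "x \<in> carrier F \<Longrightarrow> twist c x \<in> carrier F"
  by (simp add: twist_def)

lemma twist_twist [simp]: "x \<in> carrier F \<Longrightarrow> twist c (twist c x) = x"
  using frob_frob[OF setting] by (simp add: twist_def)

lemma twist_zero [simp]: "twist c \<zero> = \<zero>"
  using q_gt_1 by (simp add: twist_def F.nat_pow_zero)

lemma twist_one_C [simp]: "twist \<one>\<^bsub>C\<^esub> x = x"
  by (simp add: twist_def)

lemma twist_mult:
  "x \<in> carrier F \<Longrightarrow> y \<in> carrier F \<Longrightarrow> twist c (x \<otimes> y) = twist c x \<otimes> twist c y"
  by (simp add: twist_def F.nat_pow_distrib)

lemma phi_involution:
  "phi C F q \<in> carrier (phi_group C F q)"
  "phi C F q \<otimes>\<^bsub>phi_group C F q\<^esub> phi C F q = \<one>\<^bsub>phi_group C F q\<^esub>"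
proof -
  interpret R: group "RAutoGroup (base_group C F)" by (intro group_RAutoGroup group_base_group C F)
  have phi: "phi C F q \<in> carrier (RAutoGroup (base_group C F))"
    using phi_auto[OF setting] by (simp add: RAutoGroup_def)
  then show "phi C F q \<in> carrier (phi_group C F q)"
    by (simp add: phi_group_def carrier_subgroup_generated generate.incl)
  show "phi C F q \<otimes>\<^bsub>phi_group C F q\<^esub> phi C F q = \<one>\<^bsub>phi_group C F q\<^esub>"
    using R.pow_ord_eq_1[OF phi] phi by (simp add: phi_ord_2[OF setting] phi_group_def numeral_2_eq_2)
qed

lemma phi_group_one_apply: "g \<in> carrier (base_group C F) \<Longrightarrow> \<one>\<^bsub>phi_group C F q\<^esub> g = g"
  by (simp add: phi_group_def RAutoGroup_one_apply del: base_group_simps)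

lemma phi_group: "group (phi_group C F q)"
  unfolding phi_group_def
  by (intro group.group_subgroup_generated group_RAutoGroup group_base_group C F)

lemma elem_inject [simp]: "elem b x y = elem c x' y' \<longleftrightarrow> b = c \<and> x = x' \<and> y = y'"
  by (auto simp: elem_def)

text \<open>Inverting \<open>b\<close> preserves its parity, so the \<open>\<langle>\<phi>\<rangle>\<close>-parts, which multiply in a group of order
  two, agree with the parities of the \<open>\<langle>w\<rangle>\<close>-parts. This is the reason why the elements with matching
  parity are closed under multiplication.\<close>

lemma elem_mult:
  assumes "b \<in> carrier C" "c \<in> carrier C" "x \<in> carrier F" "y \<in> carrier F"
  shows "elem b x y \<otimes>\<^bsub>X\<^esub> elem c x' y' = elem (ctwist c b \<otimes>\<^bsub>C\<^esub> c) (twist c x \<oplus> x') (twist c y \<oplus> y')"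
proof -
  interpret P: group "phi_group C F q" by (rule phi_group)
  show ?thesis
    using assms phi_involution
    by (auto simp: elem_def extended_group_def phi_group_one_apply phi_def ctwist_def twist_def
        mult_evens inv_evens)
qed

lemma elem_one: "\<one>\<^bsub>X\<^esub> = elem \<one>\<^bsub>C\<^esub> \<zero> \<zero>"
  by (simp add: elem_def extended_group_def)

lemma group_X: "group X"
  by (rule group_extended_group[OF setting])

lemma elem_closed:
  "c \<in> carrier C \<Longrightarrow> x \<in> carrier F \<Longrightarrow> y \<in> carrier F \<Longrightarrow> elem c x y \<in> carrier X"
  using phi_involution(1) group.is_monoid[OF phi_group]
  by (auto simp: elem_def extended_group_def monoid.one_closed)

definition elems :: "(('c \<times> 'f \<times> 'f \<Rightarrow> 'c \<times> 'f \<times> 'f) \<times> 'c \<times> 'f \<times> 'f) set" where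
  "elems = {elem c x y | c x y. c \<in> carrier C \<and> x \<in> carrier F \<and> y \<in> carrier F}"

lemma elems_subgroup: "subgroup elems X"
proof -
  interpret X: group X by (rule group_X)
  show ?thesis
  proof (rule X.subgroupI)
    show "elems \<subseteq> carrier X" using elem_closed by (auto simp: elems_def)
    show "elems \<noteq> {}" using w unfolding elems_def by blast
    fix a assume a: "a \<in> elems"
    then obtain c x y where *: "a = elem c x y" "c \<in> carrier C" "x \<in> carrier F" "y \<in> carrier F"
      by (auto simp: elems_def)
    (* In a product the right factor twists the left one, so b is the inverse twisted in advance. *)
    define b where "b = elem (inv\<^bsub>C\<^esub> (ctwist c c)) (twist c (\<ominus> x)) (twist c (\<ominus> y))"
    have "b \<otimes>\<^bsub>X\<^esub> a = \<one>\<^bsub>X\<^esub>"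
      using * by (simp add: b_def elem_mult elem_one F.l_neg)
        (simp add: ctwist_def)
    moreover have "b \<in> elems" using * by (auto simp: elems_def b_def)
    moreover have "a \<in> carrier X" "b \<in> carrier X" using * elem_closed by (auto simp: b_def)
    ultimately show "inv\<^bsub>X\<^esub> a \<in> elems" using X.inv_equality by metis
  next
    fix a b assume "a \<in> elems" "b \<in> elems"
    then show "a \<otimes>\<^bsub>X\<^esub> b \<in> elems"
      by (fastforce simp: elems_def elem_mult)
  qed
qed

lemma pow_even_generate:
  "elem (w [^]\<^bsub>C\<^esub> (2 * k)) \<zero> \<zero> \<in> generate X (calG_generators C F w q)"
  for k :: nat
proof -
  interpret X: group X by (rule group_X)
  have sub: "calG_generators C F w q \<subseteq> carrier X" by (rule calG_generators_subset[OF setting])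
  show ?thesis
  proof (induction k)
    case 0
    then show ?case using generate.one[of X] by (simp add: elem_one)
  next
    case (Suc k)
    have e: "w [^]\<^bsub>C\<^esub> (2::nat) \<in> evens" "w [^]\<^bsub>C\<^esub> (2 * k) \<in> evens" by (simp_all add: w_pow_evens)
    have "elem (w [^]\<^bsub>C\<^esub> (2::nat)) \<zero> \<zero> \<in> calG_generators C F w q"
      using e by (simp add: elem_def calG_generators_def)
    then have "elem (w [^]\<^bsub>C\<^esub> (2::nat)) \<zero> \<zero> \<otimes>\<^bsub>X\<^esub> elem (w [^]\<^bsub>C\<^esub> (2 * k)) \<zero> \<zero>
        \<in> generate X (calG_generators C F w q)"
      by (intro generate.eng[OF generate.incl Suc])
    moreover have "elem (w [^]\<^bsub>C\<^esub> (2::nat)) \<zero> \<zero> \<otimes>\<^bsub>X\<^esub> elem (w [^]\<^bsub>C\<^esub> (2 * k)) \<zero> \<zero>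
        = elem (w [^]\<^bsub>C\<^esub> (2 * Suc k)) \<zero> \<zero>"
      using e w by (simp add: elem_mult ctwist_def C.nat_pow_mult)
    ultimately show ?case by simp
  qed
qed

text \<open>An odd power of \<open>w\<close> is \<open>w\<close> times an even one, and an even \<open>\<langle>w\<rangle>\<close>-part on the right twists
  nothing. So one factor \<open>(\<phi>, w)\<close>, powers of \<open>(1, w\<^sup>2)\<close> and one vector reach every element.\<close>

lemma elem_generate:
  assumes c: "c \<in> carrier C" and x: "x \<in> carrier F" and y: "y \<in> carrier F"
  shows "elem c x y \<in> generate X (calG_generators C F w q)"
proof -
  have "elem c \<zero> \<zero> \<in> generate X (calG_generators C F w q)"
  proof (cases "c \<in> evens")
    case True
    then show ?thesis using pow_even_generate by (auto simp: evens_pow)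
  next
    case False
    obtain k :: nat where k: "c = w [^]\<^bsub>C\<^esub> k" using c w_pow by auto
    then have "odd k" using False w_pow_evens[of k] by blast
    then obtain j where j: "k = 2 * j + 1" by (elim oddE)
    have e: "w [^]\<^bsub>C\<^esub> (2 * j) \<in> evens" by (simp add: w_pow_evens)
    have "c = w \<otimes>\<^bsub>C\<^esub> w [^]\<^bsub>C\<^esub> (2 * j)" using k j w by (simp add: C_comm)
    then have "elem c \<zero> \<zero> = elem w \<zero> \<zero> \<otimes>\<^bsub>X\<^esub> elem (w [^]\<^bsub>C\<^esub> (2 * j)) \<zero> \<zero>"
      using w e by (simp add: elem_mult ctwist_def)
    moreover have "elem w \<zero> \<zero> \<in> calG_generators C F w q"
      using w_not_evens by (simp add: elem_def calG_generators_def)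
    ultimately show ?thesis using pow_even_generate by (auto intro: generate.eng generate.incl)
  qed
  moreover have "elem \<one>\<^bsub>C\<^esub> x y \<in> calG_generators C F w q"
    using x y by (auto simp: elem_def calG_generators_def)
  moreover have "elem c x y = elem c \<zero> \<zero> \<otimes>\<^bsub>X\<^esub> elem \<one>\<^bsub>C\<^esub> x y"
    using c x y by (simp add: elem_mult ctwist_def)
  ultimately show ?thesis by (metis generate.eng generate.incl)
qed

lemma carrier_calG: "carrier \<G> = elems"
proof -
  interpret X: group X by (rule group_X)
  have "generate X (calG_generators C F w q) \<subseteq> elems"
  proof (rule X.generate_subgroup_incl[OF _ elems_subgroup])
    have "(phi C F q, w, \<zero>, \<zero>) = elem w \<zero> \<zero>"
      "(\<one>\<^bsub>phi_group C F q\<^esub>, w [^]\<^bsub>C\<^esub> (2::nat), \<zero>, \<zero>) = elem (w [^]\<^bsub>C\<^esub> (2::nat)) \<zero> \<zero>"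
      "\<And>s t. (\<one>\<^bsub>phi_group C F q\<^esub>, \<one>\<^bsub>C\<^esub>, s, t) = elem \<one>\<^bsub>C\<^esub> s t"
      using w_not_evens by (simp_all add: elem_def w_pow_evens)
    then show "calG_generators C F w q \<subseteq> elems"
      using w by (auto simp: calG_generators_def elems_def)
  qed
  moreover have "elems \<subseteq> generate X (calG_generators C F w q)"
    using elem_generate by (auto simp: elems_def)
  ultimately show ?thesis
    using calG_generators_subset[OF setting]
    by (auto simp: calG_def carrier_subgroup_generated Int_absorb1)
qed

lemma calG_mult [simp]: "a \<otimes>\<^bsub>\<G>\<^esub> b = a \<otimes>\<^bsub>X\<^esub> b"
  by (simp add: calG_def)

lemma calG_one: "\<one>\<^bsub>\<G>\<^esub> = elem \<one>\<^bsub>C\<^esub> \<zero> \<zero>"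
  by (simp add: calG_def elem_one)

lemma group_calG: "group \<G>"
  unfolding calG_def by (intro group.group_subgroup_generated group_X)

lemma finite_calG: "finite (carrier \<G>)"
proof -
  have "carrier \<G> = (\<lambda>(c, x, y). elem c x y) ` (carrier C \<times> carrier F \<times> carrier F)"
    by (force simp: carrier_calG elems_def)
  then show ?thesis using fin_C fin_F by simp
qed

text \<open>Otherwise all \<open>q\<^sup>2 - 1\<close> nonzero elements would be roots of \<open>x\<^sup>q\<^sup>-\<^sup>1 = 1\<close>.\<close>

lemma frobenius_nontrivial: "\<exists>x \<in> carrier F. x [^] q \<noteq> x"
proof (rule ccontr)
  assume "\<not> ?thesis"
  then have *: "x [^] q = x" if "x \<in> carrier F" for x using that by blast
  have "carrier F - {\<zero>} \<subseteq> {x \<in> carrier F. x [^] (q - 1) = \<one>}"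
  proof clarify
    fix x assume x: "x \<in> carrier F" "x \<noteq> \<zero>"
    have "x [^] (q - 1) \<otimes> x = x [^] Suc (q - 1)" by simp
    also have "\<dots> = \<one> \<otimes> x" using * x q_gt_1 by simp
    finally show "x [^] (q - 1) = \<one>" using x F.m_rcancel[of x "x [^] (q - 1)" \<one>] by simp
  qed
  then have "card (carrier F - {\<zero>}) \<le> card {x \<in> carrier F. x [^] (q - 1) = \<one>}"
    using fin_F by (intro card_mono) auto
  also have "\<dots> \<le> q - 1" using q_gt_1 fin_F by (intro F.num_roots_le_deg) auto
  finally have "q\<^sup>2 - 1 \<le> q - 1" using card_F fin_F by simp
  moreover have "q\<^sup>2 > q" using q_gt_1 by (simp add: power2_eq_square)
  ultimately show False using q_gt_1 by linarith
qed

lemma calG_not_comm: "\<not> comm_group \<G>"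
proof
  assume "comm_group \<G>"
  then interpret G: comm_group \<G> .
  obtain x where x: "x \<in> carrier F" "x [^] q \<noteq> x" using frobenius_nontrivial by blast
  have "elem w \<zero> \<zero> \<in> carrier \<G>" "elem \<one>\<^bsub>C\<^esub> x \<zero> \<in> carrier \<G>"
    using w x by (auto simp: carrier_calG elems_def)
  then have "elem \<one>\<^bsub>C\<^esub> x \<zero> \<otimes>\<^bsub>\<G>\<^esub> elem w \<zero> \<zero> = elem w \<zero> \<zero> \<otimes>\<^bsub>\<G>\<^esub> elem \<one>\<^bsub>C\<^esub> x \<zero>"
    by (intro G.m_comm)
  then show False using w x w_not_evens by (simp add: elem_mult twist_def)
qed

section \<open>Lines of the plane and the difference set\<close>

text \<open>Closure under addition suffices for a subgroup because in characteristic two each vector is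
  its own inverse.\<close>

lemma vector_subgroup:
  assumes W: "W \<subseteq> carrier F \<times> carrier F" "(\<zero>, \<zero>) \<in> W"
    and add: "\<And>x y x' y'. (x, y) \<in> W \<Longrightarrow> (x', y') \<in> W \<Longrightarrow> (x \<oplus> x', y \<oplus> y') \<in> W"
  shows "subgroup ((\<lambda>(x, y). elem \<one>\<^bsub>C\<^esub> x y) ` W) \<G>"
proof -
  interpret G: group \<G> by (rule group_calG)
  let ?S = "(\<lambda>(x, y). elem \<one>\<^bsub>C\<^esub> x y) ` W"
  show ?thesis
  proof (rule G.subgroupI)
    show sub: "?S \<subseteq> carrier \<G>" using W(1) by (fastforce simp: carrier_calG elems_def)
    show "?S \<noteq> {}" using W(2) by auto
    fix a assume a: "a \<in> ?S"
    then have aa: "a \<otimes>\<^bsub>\<G>\<^esub> a = \<one>\<^bsub>\<G>\<^esub>"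
      using W(1) char2[OF setting] by (auto simp: elem_mult calG_one subset_eq)
    have "inv\<^bsub>\<G>\<^esub> a = a" using a sub by (intro G.inv_equality[OF aa]) auto
    then show "inv\<^bsub>\<G>\<^esub> a \<in> ?S" using a by simp
  next
    fix a b assume "a \<in> ?S" "b \<in> ?S"
    then obtain x y x' y' where *: "(x, y) \<in> W" "(x', y') \<in> W"
      "a = elem \<one>\<^bsub>C\<^esub> x y" "b = elem \<one>\<^bsub>C\<^esub> x' y'" by auto
    then have "a \<otimes>\<^bsub>\<G>\<^esub> b = elem \<one>\<^bsub>C\<^esub> (x \<oplus> x') (y \<oplus> y')"
      using W(1) by (auto simp: elem_mult)
    then show "a \<otimes>\<^bsub>\<G>\<^esub> b \<in> ?S" using add[OF *(1,2)] by force
  qed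
qed

definition vectors :: "(('c \<times> 'f \<times> 'f \<Rightarrow> 'c \<times> 'f \<times> 'f) \<times> 'c \<times> 'f \<times> 'f) set" where
  "vectors = (\<lambda>(x, y). elem \<one>\<^bsub>C\<^esub> x y) ` (carrier F \<times> carrier F)"

definition line :: "'f \<Rightarrow> (('c \<times> 'f \<times> 'f \<Rightarrow> 'c \<times> 'f \<times> 'f) \<times> 'c \<times> 'f \<times> 'f) set" where
  "line m = (\<lambda>(x, y). elem \<one>\<^bsub>C\<^esub> x y) ` ((\<lambda>x. (x, m \<otimes> x)) ` carrier F)"

definition vertical_line :: "(('c \<times> 'f \<times> 'f \<Rightarrow> 'c \<times> 'f \<times> 'f) \<times> 'c \<times> 'f \<times> 'f) set" where
  "vertical_line = (\<lambda>(x, y). elem \<one>\<^bsub>C\<^esub> x y) ` ({\<zero>} \<times> carrier F)"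

lemma inj_vector: "inj_on (\<lambda>(x, y). elem \<one>\<^bsub>C\<^esub> x y) W"
  by (auto simp: inj_on_def)

lemma l_coset_vectors:
  assumes "c \<in> carrier C" "x \<in> carrier F" "y \<in> carrier F"
  shows "elem c x y <#\<^bsub>\<G>\<^esub> vectors = {elem c x y | x y. x \<in> carrier F \<and> y \<in> carrier F}"
proof -
  have "\<exists>x'' \<in> carrier F. \<exists>y'' \<in> carrier F. x' = x \<oplus> x'' \<and> y' = y \<oplus> y''"
    if "x' \<in> carrier F" "y' \<in> carrier F" for x' y'
    using that assms
    by (intro bexI[of _ "\<ominus> x \<oplus> x'"] bexI[of _ "\<ominus> y \<oplus> y'"]) (auto simp: F.r_neg1 F.r_neg2)
  then show ?thesis
    using assms by (fastforce simp: l_coset_def vectors_def elem_mult ctwist_def)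
qed

lemma vectors_normal: "vectors \<lhd> \<G>"
proof -
  interpret G: group \<G> by (rule group_calG)
  have "subgroup vectors \<G>"
    unfolding vectors_def by (rule vector_subgroup) auto
  moreover have "vectors #>\<^bsub>\<G>\<^esub> a = a <#\<^bsub>\<G>\<^esub> vectors" if a_in: "a \<in> carrier \<G>" for a
  proof -
    obtain c x y where a: "a = elem c x y" "c \<in> carrier C" "x \<in> carrier F" "y \<in> carrier F"
      using a_in by (auto simp: carrier_calG elems_def)
    have "\<exists>x'' \<in> carrier F. \<exists>y'' \<in> carrier F. x' = twist c x'' \<oplus> x \<and> y' = twist c y'' \<oplus> y"
      if "x' \<in> carrier F" "y' \<in> carrier F" for x' y'
      using that a
      by (intro bexI[of _ "twist c (x' \<oplus> \<ominus> x)"] bexI[of _ "twist c (y' \<oplus> \<ominus> y)"])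
        (auto simp: F.a_assoc F.l_neg)
    then have "vectors #>\<^bsub>\<G>\<^esub> a = {elem c x y | x y. x \<in> carrier F \<and> y \<in> carrier F}"
      using a by (fastforce simp: r_coset_def vectors_def elem_mult)
    then show ?thesis using l_coset_vectors a by simp
  qed
  ultimately show ?thesis by (intro G.normalI) auto
qed

text \<open>The odd powers of \<open>w\<close> receive slopes from a Frobenius-invariant set \<open>M\<close> of size \<open>q\<^sup>2 / 2\<close>, the
  even ones the remaining slopes. The Frobenius map then only permutes the slopes within \<open>M\<close>.\<close>

lemma slopes_exist:
  "\<exists>h. bij_betw h (carrier C) (carrier F) \<and> bij_betw (\<lambda>c. twist c (h c)) (carrier C) (carrier F)"
proof -
  let ?odds = "carrier C - evens"
  have "bij_betw (\<lambda>c. w \<otimes>\<^bsub>C\<^esub> c) evens ?odds"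
  proof (rule bij_betw_byWitness[where f' = "\<lambda>c. inv\<^bsub>C\<^esub> w \<otimes>\<^bsub>C\<^esub> c"])
    show "\<forall>a\<in>evens. inv\<^bsub>C\<^esub> w \<otimes>\<^bsub>C\<^esub> (w \<otimes>\<^bsub>C\<^esub> a) = a" "\<forall>a\<in>?odds. w \<otimes>\<^bsub>C\<^esub> (inv\<^bsub>C\<^esub> w \<otimes>\<^bsub>C\<^esub> a) = a"
      using w evens_carrier by (auto simp: C.m_assoc[symmetric])
    show "(\<otimes>\<^bsub>C\<^esub>) w ` evens \<subseteq> ?odds" "(\<otimes>\<^bsub>C\<^esub>) (inv\<^bsub>C\<^esub> w) ` ?odds \<subseteq> evens"
      using w w_not_evens evens_carrier by (auto simp: mult_evens inv_evens)
  qed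
  then have "card evens = card ?odds" by (rule bij_betw_same_card)
  moreover have "card ?odds = q\<^sup>2 - card evens"
    using fin_C card_C evens_carrier by (subst card_Diff_subset) (auto intro: finite_subset)
  moreover have "card evens \<le> q\<^sup>2"
    using fin_C card_C evens_carrier card_mono[of "carrier C" evens] by auto
  ultimately have odds: "2 * card ?odds = q\<^sup>2" and evens: "2 * card evens = q\<^sup>2" by auto
  (* The set M is built from pairs, so its size q^2 / 2 has to be even. *)
  obtain e where "q = 2 * 2 ^ e" using d q by (cases d) auto
  then have "4 dvd q\<^sup>2" by (simp add: power_mult_distrib)
  then obtain k where k: "q\<^sup>2 = 4 * k" by blast
  then have "2 * k \<le> card (carrier F)" using card_F by simp
  then have "\<exists>M \<subseteq> carrier F. card M = 2 * k \<and> (\<lambda>x. x [^] q) ` M = M"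
    using frob_frob[OF setting] by (intro involution_invariant_subset fin_F) auto
  then obtain M where M: "M \<subseteq> carrier F" "card M = 2 * k" "(\<lambda>x. x [^] q) ` M = M"
    by (elim exE conjE)
  have finM: "finite M" using M(1) fin_F finite_subset by blast
  have "card ?odds = card M" "card evens = card (carrier F - M)"
    using M odds evens k card_F finM by (auto simp: card_Diff_subset)
  then obtain h1 h2 where h1: "bij_betw h1 evens (carrier F - M)" and h2: "bij_betw h2 ?odds M"
    using fin_C fin_F finM evens_carrier
    by (metis (no_types, lifting) finite_Diff finite_same_card_bij finite_subset subsetI)
  define h where "h c = (if c \<in> evens then h1 c else h2 c)" for c
  have C_split: "carrier C = evens \<union> ?odds" and F_split: "carrier F = (carrier F - M) \<union> M"
    using evens_carrier M(1) by auto
  have inj: "inj_on (\<lambda>x. x [^] q) M"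
    using M(1) frob_frob[OF setting] by (intro inj_on_inverseI[of _ "\<lambda>x. x [^] q"]) auto
  have "bij_betw h evens (carrier F - M)" "bij_betw h ?odds M"
    using bij_betw_cong[of evens h1 h] bij_betw_cong[of ?odds h2 h] h1 h2 by (simp_all add: h_def)
  then have "bij_betw h (evens \<union> ?odds) ((carrier F - M) \<union> M)"
    by (intro bij_betw_combine) auto
  moreover have "bij_betw (\<lambda>c. twist c (h c)) evens (carrier F - M)"
    using bij_betw_cong[of evens h1 "\<lambda>c. twist c (h c)"] h1 by (simp add: h_def twist_def)
  moreover have "bij_betw (\<lambda>c. twist c (h c)) ?odds M"
  proof -
    have "bij_betw ((\<lambda>x. x [^] q) \<circ> h2) ?odds M"
      using h2 inj M(3) by (intro bij_betw_trans[of _ _ M]) (auto simp: bij_betw_def)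
    then show ?thesis
      using bij_betw_cong[of ?odds "(\<lambda>x. x [^] q) \<circ> h2" "\<lambda>c. twist c (h c)"]
      by (simp add: h_def twist_def)
  qed
  then have "bij_betw (\<lambda>c. twist c (h c)) (evens \<union> ?odds) ((carrier F - M) \<union> M)"
    using calculation(2) by (intro bij_betw_combine) auto
  ultimately show ?thesis using C_split F_split by metis
qed

text \<open>Moving a vector past the element over \<open>c\<close> twists it, so the condition that \<open>(x, y)\<close> lies on the
  conjugate of the line of slope \<open>h c\<close> says that its slope is \<open>twist c (h c)\<close>. The assumption \<open>h'\<close>
  makes each vector off the vertical line satisfy this for exactly one \<open>c\<close>.\<close>

lemma relative_difference_set_calG:
  assumes h: "bij_betw h (carrier C) (carrier F)"
    and h': "bij_betw (\<lambda>c. twist c (h c)) (carrier C) (carrier F)"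
  shows "relative_difference_set \<G> vertical_line ((q\<^sup>2)\<^sup>2) (q\<^sup>2) ((q\<^sup>2)\<^sup>2) (q\<^sup>2)
    (\<Union>c\<in>carrier C. elem c \<zero> \<zero> <#\<^bsub>\<G>\<^esub> line (h c))"
proof -
  interpret G: group \<G> by (rule group_calG)
  have hF: "h c \<in> carrier F" if "c \<in> carrier C" for c using h that by (auto simp: bij_betw_def)
  have on_line: "elem \<one>\<^bsub>C\<^esub> x y \<otimes>\<^bsub>\<G>\<^esub> elem c \<zero> \<zero> \<in> elem c \<zero> \<zero> <#\<^bsub>\<G>\<^esub> line (h c)
      \<longleftrightarrow> y = twist c (h c) \<otimes> x"
    if "x \<in> carrier F" "y \<in> carrier F" "c \<in> carrier C" for x y c
  proof -
    have "elem \<one>\<^bsub>C\<^esub> x y \<otimes>\<^bsub>\<G>\<^esub> elem c \<zero> \<zero> \<in> elem c \<zero> \<zero> <#\<^bsub>\<G>\<^esub> line (h c)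
        \<longleftrightarrow> twist c y = h c \<otimes> twist c x"
      using that hF by (auto simp: l_coset_def line_def elem_mult ctwist_def)
    also have "\<dots> \<longleftrightarrow> twist c (twist c y) = twist c (h c \<otimes> twist c x)"
      using that hF by (metis F.m_closed twist_closed twist_twist)
    also have "\<dots> \<longleftrightarrow> y = twist c (h c) \<otimes> x"
      using that hF by (simp add: twist_mult)
    finally show ?thesis .
  qed
  show ?thesis
  proof (rule G.relative_difference_set_transversal)
    show "finite (carrier \<G>)" by (rule finite_calG)
    show "vectors \<lhd> \<G>" by (rule vectors_normal)
    show "card vectors = (q\<^sup>2)\<^sup>2"
      by (simp add: vectors_def card_image[OF inj_vector] card_cartesian_product card_F power2_eq_square)
    show "card (carrier C) = q\<^sup>2" by (rule card_C)
    show "q\<^sup>2 > 0" using q_gt_1 by simp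
    show "elem c \<zero> \<zero> \<in> carrier \<G>" if "c \<in> carrier C" for c
      using that by (auto simp: carrier_calG elems_def)
    show "\<exists>!c. c \<in> carrier C \<and> g \<in> elem c \<zero> \<zero> <#\<^bsub>\<G>\<^esub> vectors" if "g \<in> carrier \<G>" for g
      using that by (auto simp: carrier_calG elems_def l_coset_vectors)
    show "subgroup (line (h c)) \<G>" "line (h c) \<subseteq> vectors" "card (line (h c)) = q\<^sup>2"
      if "c \<in> carrier C" for c
    proof -
      show "subgroup (line (h c)) \<G>"
        unfolding line_def using hF[OF that] by (intro vector_subgroup) (auto simp: F.r_distr image_iff)
      show "line (h c) \<subseteq> vectors"
        unfolding line_def vectors_def using hF[OF that] by (intro image_mono) auto
      have "inj_on (\<lambda>x. (x, h c \<otimes> x)) (carrier F)" by (auto simp: inj_on_def)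
      then show "card (line (h c)) = q\<^sup>2"
        by (simp add: line_def card_image[OF inj_vector] card_image card_F)
    qed
    show "line (h b) \<inter> line (h c) = {\<one>\<^bsub>\<G>\<^esub>}"
      if "b \<in> carrier C" "c \<in> carrier C" "b \<noteq> c" for b c
    proof -
      have "h b \<noteq> h c" using h that by (auto simp: bij_betw_def inj_on_def)
      then have "x = \<zero>" if "x \<in> carrier F" "h b \<otimes> x = h c \<otimes> x" for x
        using that hF \<open>b \<in> carrier C\<close> \<open>c \<in> carrier C\<close> F.m_rcancel by blast
      then show ?thesis using hF[OF \<open>b \<in> carrier C\<close>] hF[OF \<open>c \<in> carrier C\<close>]
        by (fastforce simp: line_def calG_one image_iff)
    qed
    show "subgroup vertical_line \<G>"
      unfolding vertical_line_def by (rule vector_subgroup) auto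
    show "vertical_line \<subseteq> vectors"
      unfolding vertical_line_def vectors_def by (intro image_mono) auto
    show "card vertical_line = q\<^sup>2"
      by (simp add: vertical_line_def card_image[OF inj_vector] card_cartesian_product card_F)
    show "\<exists>!c. c \<in> carrier C \<and> g \<otimes>\<^bsub>\<G>\<^esub> elem c \<zero> \<zero> \<in> elem c \<zero> \<zero> <#\<^bsub>\<G>\<^esub> line (h c)"
      if g_in: "g \<in> vectors - vertical_line" for g
    proof -
      obtain x y where g: "g = elem \<one>\<^bsub>C\<^esub> x y" "x \<in> carrier F" "y \<in> carrier F" "x \<noteq> \<zero>"
        using g_in by (auto simp: vectors_def vertical_line_def)
      have inv: "inv x \<in> carrier F" "inv x \<otimes> x = \<one>" using g F.field_Units by auto
      have "y = m \<otimes> x \<longleftrightarrow> m = y \<otimes> inv x" if "m \<in> carrier F" for m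
        using that g inv by (metis F.m_assoc F.m_comm F.r_one)
      then have "c \<in> carrier C \<and> g \<otimes>\<^bsub>\<G>\<^esub> elem c \<zero> \<zero> \<in> elem c \<zero> \<zero> <#\<^bsub>\<G>\<^esub> line (h c)
          \<longleftrightarrow> c \<in> carrier C \<and> twist c (h c) = y \<otimes> inv x" for c
        using on_line[of x y c] g hF by auto
      moreover have "\<exists>!c. c \<in> carrier C \<and> twist c (h c) = y \<otimes> inv x"
      proof -
        have "y \<otimes> inv x \<in> (\<lambda>c. twist c (h c)) ` carrier C"
          using bij_betw_imp_surj_on[OF h'] g inv by simp
        then obtain c where "c \<in> carrier C" "twist c (h c) = y \<otimes> inv x" by auto
        then show ?thesis using inj_onD[OF bij_betw_imp_inj_on[OF h']] by (intro ex1I[of _ c]) auto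
      qed
      ultimately show ?thesis by simp
    qed
    show "g \<otimes>\<^bsub>\<G>\<^esub> elem c \<zero> \<zero> \<notin> elem c \<zero> \<zero> <#\<^bsub>\<G>\<^esub> line (h c)"
      if "g \<in> vertical_line" "g \<noteq> \<one>\<^bsub>\<G>\<^esub>" "c \<in> carrier C" for g c
      using that on_line[of \<zero> _ c] hF by (auto simp: vertical_line_def calG_one)
  qed
qed

end

theorem theorem8p1:
  fixes d q :: nat
    and F :: "('f, 'n) ring_scheme"
    and C :: "('c, 'm) monoid_scheme"
    and w :: 'c
  assumes "d \<ge> 1" and "q = 2 ^ d"
    and "field F" and "order F = q\<^sup>2"
    and "group C" and "w \<in> carrier C" and "carrier C = generate C {w}" and "order C = q\<^sup>2"
  shows "group (calG C F w q) \<and> \<not> comm_group (calG C F w q) \<and>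
         contains_RDS (calG C F w q) (q ^ 4) (q ^ 2) (q ^ 4) (q ^ 2)"
proof -
  interpret frobenius_extension d q F C w using assms by (rule frobenius_extension.intro)
  have "contains_RDS (calG C F w q) ((q\<^sup>2)\<^sup>2) (q\<^sup>2) ((q\<^sup>2)\<^sup>2) (q\<^sup>2)"
    using slopes_exist relative_difference_set_calG unfolding contains_RDS_def by blast
  then show ?thesis using group_calG calG_not_comm by (simp flip: power_mult)
qed

end
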